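(* Let $q$ be a prime power, let $m\ge 1$ and $n\geq 2$ be integers, let $h$ be an integer with $1\le h\le m$, and let $X$ be a vector space over $\mathbb{F}_q$ of dimension $mn$. There exists an $m$-spread $\mathcal{A}$ in $X$ for which there exists an $(\mathcal{A},h)$-evasive $\mathbb{F}_q$-subspace of $X$ of dimension $m(n-1)+h-1$.
   Context: An $m$-spread of $X$ is a collection $\mathcal{A}$ of $m$-dimensional $\mathbb{F}_q$-subspaces of $X$, pairwise intersecting trivially, such that every non-zero vector of $X$ lies in exactly one element of $\mathcal{A}$. An $\mathbb{F}_q$-subspace $U\le X$ is $(\mathcal{A},h)$-evasive if $\dim_{\mathbb{F}_q}(U\cap S)\leq h$ for all $S\in\mathcal{A}$. *)

theory Defs
  imports "HOL-Number_Theory.Prime_Powers"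
begin

context vector_space
begin

definition is_spread :: "nat \<Rightarrow> 'b set \<Rightarrow> 'b set set \<Rightarrow> bool" where
  "is_spread m X A \<longleftrightarrow>
     (\<forall>S\<in>A. subspace S \<and> S \<subseteq> X \<and> dim S = m) \<and>
     (\<forall>S\<in>A. \<forall>T\<in>A. S \<noteq> T \<longrightarrow> S \<inter> T = {0}) \<and>
     (\<forall>x\<in>X. x \<noteq> 0 \<longrightarrow> (\<exists>!S. S \<in> A \<and> x \<in> S))"

text \<open>The library's \<^const>\<open>dim\<close> is 0 on infinite-dimensional subspaces, so the bound on
  the dimensions below has its intended meaning only for finite-dimensional \<open>X\<close>.\<close>

definition is_evasive :: "'b set \<Rightarrow> 'b set set \<Rightarrow> nat \<Rightarrow> 'b set \<Rightarrow> bool" where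
  "is_evasive X A h U \<longleftrightarrow>
     subspace U \<and> U \<subseteq> X \<and> (\<forall>S\<in>A. dim (U \<inter> S) \<le> h)"

end

end

theory Submission
  imports Defs "HOL-Number_Theory.Residues" "HOL-Algebra.Algebraic_Closure_Type" "HOL-Library.Product_Plus"
begin

text \<open>
  Let \<open>K\<close> and \<open>L\<close> be the fields with \<open>q\<^sup>m\<close> and \<open>q\<^bsup>m(n-1)\<^esup>\<close> elements, so that \<open>X\<close> may be taken
  to be \<open>L \<times> K\<close>. In place of the Desarguesian spread one takes \<open>{0} \<times> K\<close> together with the
  subspaces \<open>{(v x, x\<^sup>q - l x) | x \<in> K}\<close>, where \<open>l\<close> ranges over \<open>K\<close> and \<open>v\<close> over representatives
  of the points of \<open>L\<close> over \<open>K\<close>: since \<open>v\<close> and \<open>x\<close> are determined by \<open>v x\<close>, a vector \<open>(p, z)\<close>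
  with \<open>p \<noteq> 0\<close> determines \<open>l\<close>. For a subspace \<open>W\<close> of \<open>K\<close> of dimension \<open>h - 1\<close>, the subspace
  \<open>L \<times> W\<close> is evasive, because \<open>x\<^sup>q - l x \<in> W\<close> has at most \<open>q \<cdot> q\<^bsup>h-1\<^esup>\<close> solutions \<open>x\<close>.
  All dimensions are computed by counting vectors.
\<close>

hide_const (open) Divisibility.prime
no_notation var (\<open>X\<index>\<close>)

section \<open>Subfields of an algebraically closed field of prime characteristic\<close>

text \<open>Multiplication by a non-zero \<open>x\<close> permutes the non-zero elements, so their
  product is unchanged by a factor \<open>x ^ card ?G\<close>.\<close>

lemma power_card_field_eq_same:
  fixes x :: "'a::{field,finite}"
  shows "x ^ card (UNIV :: 'a set) = x"
proof (cases "x = 0")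
  case True
  then show ?thesis by (simp add: zero_power finite_UNIV_card_ge_0)
next
  case False
  let ?G = "UNIV - {0 :: 'a}"
  have "bij_betw ((*) x) ?G ?G"
    using False by (intro bij_betwI[where g = "\<lambda>y. y / x"]) auto
  then have "\<Prod>?G = (\<Prod>y\<in>?G. x * y)"
    using prod.reindex_bij_betw[of "(*) x" ?G ?G "\<lambda>y. y"] by simp
  also have "\<dots> = x ^ card ?G * \<Prod>?G"
    by (simp add: prod.distrib)
  finally have "x ^ card ?G = 1"
    by (simp add: prod_zero_iff)
  then have "x ^ Suc (card ?G) = x"
    by simp
  also have "Suc (card ?G) = card (UNIV :: 'a set)"
    by (rule card_Suc_Diff1) simp_all
  finally show ?thesis .
qed

text \<open>The characteristic is a prime dividing the number of elements, hence equals the prime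
  underlying it. This form lets the additivity of \<open>CHAR\<close> powers apply to
  \<open>q\<close>.\<close>

lemma card_field_eq_CHAR_power:
  assumes "primepow (card (UNIV :: 'a::{field,finite} set))"
  obtains e where "e > 0" "prime CHAR('a)" "card (UNIV :: 'a set) = CHAR('a) ^ e"
proof -
  obtain p e where p: "prime p" "e > 0" "card (UNIV :: 'a set) = p ^ e"
    using assms by (auto simp: primepow_def)
  have prime: "prime CHAR('a)"
    by (intro prime_CHAR_semidom finite_imp_CHAR_pos) simp
  have "CHAR('a) dvd p ^ e"
    using CHAR_dvd_CARD[where 'a = 'a] p(3) by simp
  then have "CHAR('a) = p"
    using prime p(1) by (metis prime_dvd_power primes_dvd_imp_eq)
  then show ?thesis
    using that p prime by blast
qed

text \<open>For \<open>N\<close> a positive power of the prime characteristic of an algebraically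
  closed field, this is its subfield with \<open>N\<close> elements.\<close>

definition fixed_field :: "nat \<Rightarrow> 'k::field set" where
  "fixed_field N = {x. x ^ N = x}"

lemma fixed_field_mult: "x \<in> fixed_field N \<Longrightarrow> y \<in> fixed_field N \<Longrightarrow> x * y \<in> fixed_field N"
  by (simp add: fixed_field_def power_mult_distrib)

lemma fixed_field_divide: "x \<in> fixed_field N \<Longrightarrow> y \<in> fixed_field N \<Longrightarrow> x / y \<in> fixed_field N"
  by (simp add: fixed_field_def power_divide)

lemma fixed_field_power: "x \<in> fixed_field N \<Longrightarrow> x ^ k \<in> fixed_field N"
  by (simp add: fixed_field_def flip: power_mult) (metis mult.commute power_mult)

lemma fixed_field_0: "N > 0 \<Longrightarrow> 0 \<in> fixed_field N"
  by (simp add: fixed_field_def zero_power)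

lemma fixed_field_1: "1 \<in> fixed_field N"
  by (simp add: fixed_field_def)

lemma fixed_field_subset: "fixed_field N \<subseteq> fixed_field (N ^ r)"
proof
  fix x :: 'a assume "x \<in> fixed_field N"
  then have "x ^ N = x" by (simp add: fixed_field_def)
  then have "x ^ (N ^ r) = x" by (induction r) (simp_all add: power_mult)
  then show "x \<in> fixed_field (N ^ r)" by (simp add: fixed_field_def)
qed

lemma diff_power_CHAR:
  fixes x y :: "'k::field"
  assumes "prime CHAR('k)" "N = CHAR('k) ^ e"
  shows "(x - y) ^ N = x ^ N - y ^ N"
  using freshmans_dream'[OF assms, of "x - y" y] by simp

lemma fixed_field_add:
  fixes x y :: "'k::field"
  assumes "prime CHAR('k)" "N = CHAR('k) ^ e" "x \<in> fixed_field N" "y \<in> fixed_field N"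
  shows "x + y \<in> fixed_field N"
  using assms(3,4) freshmans_dream'[OF assms(1,2), of x y] by (simp add: fixed_field_def)

lemma fixed_field_diff:
  fixes x y :: "'k::field"
  assumes "prime CHAR('k)" "N = CHAR('k) ^ e" "x \<in> fixed_field N" "y \<in> fixed_field N"
  shows "x - y \<in> fixed_field N"
  using assms(3,4) diff_power_CHAR[OF assms(1,2), of x y] by (simp add: fixed_field_def)

text \<open>The elements are the roots of \<open>monom 1 N - [:0, 1:]\<close>, which splits into
  \<open>N\<close> linear factors. A repeated root would also be a root of the derivative, but that
  is the constant -1.\<close>

lemma card_fixed_field:
  assumes "prime CHAR('k)" "N = CHAR('k) ^ e" "e > 0"
  shows "card (fixed_field N :: 'k::alg_closed_field set) = N"
proof -
  define P :: "'k poly" where "P = monom 1 N - [:0, 1:]"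
  have "CHAR('k) > 1" using assms(1) by (rule prime_gt_1_nat)
  then have N: "N > 1" using assms(2,3) one_less_power by metis
  have deg: "degree P = N"
    unfolding P_def using N
    by (subst diff_conv_add_uminus, subst degree_add_eq_left) (auto simp: degree_monom_eq)
  then have P0: "P \<noteq> 0" using N by auto
  have "of_nat N = (0 :: 'k)"
    using assms by (simp add: of_nat_eq_0_iff_char_dvd)
  then have pd: "pderiv P = -1"
    by (simp add: P_def pderiv_diff pderiv_monom pderiv_pCons one_pCons)
  obtain A where A: "size A = degree P" "P = smult (lead_coeff P) (\<Prod>x\<in>#A. [:-x, 1:])"
    using alg_closed_imp_factorization[OF P0] by blast
  have "count A a \<le> 1" for a
  proof (rule ccontr)
    assume "\<not> count A a \<le> 1"
    then have "replicate_mset 2 a \<subseteq># A"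
      by (simp flip: count_le_replicate_mset_subset_eq)
    then obtain B where B: "A = replicate_mset 2 a + B"
      using mset_subset_eq_exists_conv by blast
    define Q where "Q = smult (lead_coeff P) (\<Prod>x\<in>#B. [:-x, 1:])"
    have "P = smult (lead_coeff P) (\<Prod>x\<in>#replicate_mset 2 a + B. [:-x, 1:])"
      using A(2) unfolding B .
    also have "\<dots> = [:-a, 1:] * ([:-a, 1:] * Q)"
      unfolding Q_def by (simp add: numeral_2_eq_2 algebra_simps del: mult_pCons_left mult_pCons_right)
    finally have Q: "P = [:-a, 1:] * ([:-a, 1:] * Q)" .
    have "poly (pderiv P) a = 0"
      unfolding Q pderiv_mult by simp
    then show False
      by (simp add: pd)
  qed
  \<comment> \<open>With all multiplicities at most 1, the multiset of roots is its own support, so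
    its size counts distinct roots.\<close>
  then have "count A a = count (mset_set (set_mset A)) a" for a
    by (cases "a \<in># A") (auto simp: not_in_iff intro: le_antisym)
  then have "A = mset_set (set_mset A)"
    by (rule multiset_eqI)
  then have "card (set_mset A) = N"
    using A(1) deg by (metis size_mset_set)
  moreover have "set_mset A = fixed_field N"
  proof -
    have "x \<in># A \<longleftrightarrow> poly P x = 0" for x
      by (subst A(2)) (use P0 in \<open>auto simp: poly_prod_mset prod_mset_zero_iff\<close>)
    then show ?thesis
      by (auto simp: fixed_field_def P_def poly_monom)
  qed
  ultimately show ?thesis by simp
qed

text \<open>These are the roots of a polynomial of degree exactly \<open>q\<close>, the bound
  \<open>q > 1\<close> keeping the leading term apart from the linear one.\<close>

lemma card_roots_linearized_le:
  fixes l w :: "'k::field"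
  assumes "q > 1"
  shows "finite {x. x ^ q - l * x = w}" "card {x. x ^ q - l * x = w} \<le> q"
proof -
  define P where "P = monom 1 q + [:-w, -l:]"
  have deg: "degree P = q"
    unfolding P_def using assms by (subst degree_add_eq_left) (auto simp: degree_monom_eq)
  then have "P \<noteq> 0" using assms by auto
  moreover have "{x. x ^ q - l * x = w} = {x. poly P x = 0}"
    by (auto simp: P_def poly_monom algebra_simps)
  ultimately show "finite {x. x ^ q - l * x = w}" "card {x. x ^ q - l * x = w} \<le> q"
    using poly_roots_finite[of P] card_poly_roots_bound[of P] deg by auto
qed

section \<open>Vector spaces over a finite field\<close>

text \<open>Adjoining \<open>b\<close> outside the span of \<open>B\<close> multiplies the count by
  the size of the field, because \<open>scale c b + s\<close> determines both \<open>c\<close> and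
  \<open>s\<close>.\<close>

lemma card_span_independent:
  fixes scale :: "'a::{field,finite} \<Rightarrow> 'b::ab_group_add \<Rightarrow> 'b"
  assumes "vector_space scale" "finite B" "\<not> module.dependent scale B"
  shows "finite (module.span scale B) \<and>
         card (module.span scale B) = card (UNIV :: 'a set) ^ card B"
proof -
  interpret vector_space scale by fact
  show ?thesis
    using assms(2,3)
  proof (induction B)
    case empty
    then show ?case by simp
  next
    case (insert b B)
    then have b: "b \<notin> span B" and B: "independent B"
      by (auto simp: independent_insert)
    define f where "f = (\<lambda>(c, s). scale c b + s)"
    have inj: "inj_on f (UNIV \<times> span B)"
    proof (rule inj_onI, clarify)
      fix c s d t
      assume st: "s \<in> span B" "t \<in> span B" and "f (c, s) = f (d, t)"
      then have eq: "scale (c - d) b = t - s"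
        by (simp add: f_def scale_left_diff_distrib algebra_simps)
      have "c = d"
      proof (rule ccontr)
        assume "c \<noteq> d"
        then have "b = scale (inverse (c - d)) (t - s)"
          by (simp add: eq[symmetric])
        then show False
          using b st span_diff span_scale by metis
      qed
      then show "c = d \<and> s = t"
        using eq by simp
    qed
    have "x \<in> f ` (UNIV \<times> span B)" if "x - scale c b \<in> span B" for x c
      using that by (intro image_eqI[of _ _ "(c, x - scale c b)"]) (auto simp: f_def)
    moreover have "f (c, s) - scale c b \<in> span B" if "s \<in> span B" for c s
      using that by (simp add: f_def)
    ultimately have "span (insert b B) = f ` (UNIV \<times> span B)"
      unfolding span_insert by blast
    moreover have "finite (span B)" "card (span B) = card (UNIV :: 'a set) ^ card B"
      using insert.IH[OF B] by auto
    ultimately show ?case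
      using insert.hyps card_image[OF inj] by (auto simp: card_cartesian_product)
  qed
qed

lemma card_subspace:
  fixes scale :: "'a::{field,finite} \<Rightarrow> 'b::ab_group_add \<Rightarrow> 'b"
  assumes "vector_space scale" "module.subspace scale S" "finite S"
  shows "card S = card (UNIV :: 'a set) ^ vector_space.dim scale S"
proof -
  interpret vector_space scale by fact
  obtain B where "B \<subseteq> S" "independent B" "S \<subseteq> span B" "card B = dim S"
    using basis_exists .
  moreover from this have "span B = S"
    using assms(2) span_subspace by blast
  ultimately show ?thesis
    using card_span_independent[OF assms(1), of B] assms(3) finite_subset by metis
qed

text \<open>A field has at least two elements, so the exponent in \<open>card_subspace\<close> can
  be read off from the count.\<close>

lemma dim_eq_if_card:
  fixes scale :: "'a::{field,finite} \<Rightarrow> 'b::ab_group_add \<Rightarrow> 'b"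
  assumes "vector_space scale" "module.subspace scale S" "finite S"
    and "card S = card (UNIV :: 'a set) ^ d"
  shows "vector_space.dim scale S = d"
proof -
  have "card {0, 1 :: 'a} \<le> card (UNIV :: 'a set)" by (intro card_mono) auto
  then have "card (UNIV :: 'a set) > 1" by simp
  then show ?thesis using card_subspace[OF assms(1-3)] assms(4) by simp
qed

lemma dim_le_if_card_le:
  fixes scale :: "'a::{field,finite} \<Rightarrow> 'b::ab_group_add \<Rightarrow> 'b"
  assumes "vector_space scale" "module.subspace scale S" "finite S"
    and "card S \<le> card (UNIV :: 'a set) ^ d"
  shows "vector_space.dim scale S \<le> d"
proof -
  have "card {0, 1 :: 'a} \<le> card (UNIV :: 'a set)" by (intro card_mono) auto
  then have "card (UNIV :: 'a set) > 1" by simp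
  then show ?thesis using card_subspace[OF assms(1-3)] assms(4) by simp
qed

text \<open>A \<open>d\<close>-element subset of a basis spans such a subspace. If \<open>S\<close>
  is infinite-dimensional, \<open>dim\<close> takes its default 0, so \<open>d\<close> is 0 and the
  empty set serves.\<close>

lemma exists_subspace_of_dim:
  fixes scale :: "'a::{field,finite} \<Rightarrow> 'b::ab_group_add \<Rightarrow> 'b"
  assumes "vector_space scale" "module.subspace scale S" "d \<le> vector_space.dim scale S"
  obtains W where "module.subspace scale W" "W \<subseteq> S" "finite W"
    "card W = card (UNIV :: 'a set) ^ d"
proof -
  interpret vector_space scale by fact
  obtain B where B: "B \<subseteq> S" "independent B" "card B = dim S"
    using basis_exists by metis
  then obtain C where C: "C \<subseteq> B" "card C = d" "finite C"
    using obtain_subset_with_card_n[of d B] assms(3) by metis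
  have "independent C" using B C independent_mono by blast
  then show ?thesis
    using that[of "span C"] card_span_independent[OF assms(1), of C] C B assms(2)
    by (meson order_trans span_minimal subspace_span)
qed

section \<open>Linear isomorphisms and transport of spreads\<close>

lemma exists_isomorphism:
  fixes s1 :: "'a::{field,finite} \<Rightarrow> 'b::ab_group_add \<Rightarrow> 'b"
    and s2 :: "'a \<Rightarrow> 'c::ab_group_add \<Rightarrow> 'c"
  assumes "vector_space s1" "vector_space s2"
    and S: "module.subspace s1 S" and T: "module.subspace s2 T"
    and dim: "vector_space.dim s1 S = vector_space.dim s2 T" "vector_space.dim s1 S > 0"
  obtains g where "Vector_Spaces.linear s1 s2 g" "inj_on g S" "g ` S = T"
proof -
  interpret vector_space_pair s1 s2 using assms(1,2) by (simp add: vector_space_pair_def)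
  obtain B where B: "B \<subseteq> S" "vs1.independent B" "S \<subseteq> vs1.span B" "card B = vs1.dim S"
    using vs1.basis_exists .
  obtain C where C: "C \<subseteq> T" "vs2.independent C" "T \<subseteq> vs2.span C" "card C = vs2.dim T"
    using vs2.basis_exists .
  \<comment> \<open>An infinite basis would have \<open>card\<close> equal to 0; the positive
    dimension excludes this.\<close>
  have "finite B" "finite C" using B(4) C(4) dim by (auto intro: card_ge_0_finite)
  then show ?thesis
    using finite_basis_to_basis_subspace_isomorphism[OF S T dim(1) _ B _ C] that by blast
qed

text \<open>An injective map preserves the count of each subspace of \<open>Y\<close>, hence its
  dimension, and commutes with intersections. Injectivity holds on \<open>Y\<close> only, so every
  set involved must be kept inside \<open>Y\<close>.\<close>

lemma spread_evasive_image:
  fixes s1 :: "'a::{field,finite} \<Rightarrow> 'b::ab_group_add \<Rightarrow> 'b"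
    and s2 :: "'a \<Rightarrow> 'c::ab_group_add \<Rightarrow> 'c"
  assumes lin: "Vector_Spaces.linear s1 s2 g" and inj: "inj_on g Y" and Y: "finite Y" "module.subspace s1 Y"
    and spread: "vector_space.is_spread s1 m Y A"
    and evasive: "vector_space.is_evasive s1 Y A h U"
  shows "vector_space.is_spread s2 m (g ` Y) ((`) g ` A)"
    and "vector_space.is_evasive s2 (g ` Y) ((`) g ` A) h (g ` U)"
    and "vector_space.dim s2 (g ` U) = vector_space.dim s1 U"
proof -
  interpret Vector_Spaces.linear s1 s2 g by fact
  have dim: "vs2.dim (g ` S) = vs1.dim S" if "vs1.subspace S" "S \<subseteq> Y" for S
  proof -
    have "finite S" using that Y finite_subset by blast
    moreover have "card (g ` S) = card S" using inj that card_image inj_on_subset by metis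
    ultimately show ?thesis
      using dim_eq_if_card[OF vs2.vector_space_axioms] card_subspace[OF vs1.vector_space_axioms]
        that subspace_image by (metis finite_imageI)
  qed
  have inter: "g ` S \<inter> g ` T = g ` (S \<inter> T)" if "S \<subseteq> Y" "T \<subseteq> Y" for S T
    using inj_on_image_Int[OF inj that] by simp
  note spread = spread[unfolded vs1.is_spread_def]
  note evasive = evasive[unfolded vs1.is_evasive_def]
  have AY: "vs1.subspace S" "S \<subseteq> Y" "vs1.dim S = m" if "S \<in> A" for S
    using spread that by auto
  show "vs2.is_spread m (g ` Y) ((`) g ` A)"
    unfolding vs2.is_spread_def
  proof (intro conjI ballI impI)
    fix S' assume "S' \<in> (`) g ` A"
    then show "vs2.subspace S'" "S' \<subseteq> g ` Y" "vs2.dim S' = m"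
      using AY dim subspace_image by auto
  next
    fix S' T' assume "S' \<in> (`) g ` A" "T' \<in> (`) g ` A" "S' \<noteq> T'"
    then obtain S T where "S \<in> A" "T \<in> A" "S \<noteq> T" "S' = g ` S" "T' = g ` T" by auto
    then show "S' \<inter> T' = {0}"
      using spread inter AY by (simp add: zero)
  next
    fix y assume "y \<in> g ` Y" "y \<noteq> 0"
    then obtain x where x: "x \<in> Y" "x \<noteq> 0" "y = g x" by (metis imageE zero)
    then obtain S where S: "S \<in> A" "x \<in> S" "\<And>T. T \<in> A \<Longrightarrow> x \<in> T \<Longrightarrow> T = S"
      using spread by metis
    show "\<exists>!S'. S' \<in> (`) g ` A \<and> y \<in> S'"
    proof (rule ex1I)
      show "g ` S \<in> (`) g ` A \<and> y \<in> g ` S"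
        using S(1,2) x(3) by blast
      fix T' assume T': "T' \<in> (`) g ` A \<and> y \<in> T'"
      then obtain T where T: "T \<in> A" "T' = g ` T" by (elim conjE imageE)
      have "g x \<in> g ` T" using T' T(2) x(3) by simp
      then have "x \<in> T"
        using AY(2)[OF T(1)] x(1) inj inj_on_image_mem_iff by metis
      then show "T' = g ` S"
        using S(3) T by simp
    qed
  qed
  have U: "vs1.subspace U" "U \<subseteq> Y" using evasive by auto
  show "vs2.is_evasive (g ` Y) ((`) g ` A) h (g ` U)"
    unfolding vs2.is_evasive_def
  proof (intro conjI ballI)
    fix S' assume "S' \<in> (`) g ` A"
    then obtain S where S: "S \<in> A" "S' = g ` S" by auto
    have "vs2.dim (g ` (U \<inter> S)) = vs1.dim (U \<inter> S)"
      using S U AY by (intro dim) (auto intro: vs1.subspace_inter)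
    then show "vs2.dim (g ` U \<inter> S') \<le> h"
      using S U AY inter evasive by simp
  qed (use U subspace_image in auto)
  show "vs2.dim (g ` U) = vs1.dim U" using dim U .
qed

section \<open>The twisted spread\<close>

text \<open>Both fields are realised inside one algebraic closure of the scalar field, so that
  \<open>K\<close> lies in \<open>L\<close> and all scalars lie in both. Here \<open>r\<close>
  stands for \<open>n - 1\<close>.\<close>

lemma exists_spread_evasive_product:
  fixes sc :: "'a::{field,finite} \<Rightarrow> 'a alg_closure \<times> 'a alg_closure \<Rightarrow> 'a alg_closure \<times> 'a alg_closure"
    and m r h :: nat
  defines "q \<equiv> card (UNIV :: 'a set)"
  defines "sc \<equiv> \<lambda>c (x, y). (to_ac c * x, to_ac c * y)"
  defines "L \<equiv> fixed_field (q ^ (m * r))" and "K \<equiv> fixed_field (q ^ m)"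
  assumes q: "primepow q" and mr: "m \<ge> 1" "r \<ge> 1" and h: "1 \<le> h" "h \<le> m"
  shows "vector_space sc" "module.subspace sc (L \<times> K)" "finite (L \<times> K)"
    "vector_space.dim sc (L \<times> K) = m * (r + 1)"
    "\<exists>A U. vector_space.is_spread sc m (L \<times> K) A \<and> vector_space.is_evasive sc (L \<times> K) A h U \<and>
       vector_space.dim sc U = m * r + h - 1"
proof -

  \<comment> \<open>Arithmetic of the fields \<open>K\<close> and \<open>L\<close>\<close>
  obtain e where e: "e > 0" "prime CHAR('a alg_closure)" "q = CHAR('a alg_closure) ^ e"
    using card_field_eq_CHAR_power[where 'a = 'a] q unfolding q_def by auto
  have q1: "q > 1" using e one_less_power prime_gt_1_nat by metis
  have qpow: "q ^ k = CHAR('a alg_closure) ^ (e * k)" for k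
    by (simp add: e(3) power_mult)
  have cardF: "card (fixed_field (q ^ k) :: 'a alg_closure set) = q ^ k" if "k > 0" for k
    using card_fixed_field[OF e(2) qpow] that e(1) by simp
  have cardL: "card L = q ^ (m * r)" and cardK: "card K = q ^ m"
    using mr cardF by (simp_all add: L_def K_def)
  then have finL: "finite L" and finK: "finite K"
    using q1 by (auto intro: card_ge_0_finite)
  note add = fixed_field_add[OF e(2) qpow] and diff = fixed_field_diff[OF e(2) qpow]
  note zero = fixed_field_0[OF zero_less_power[of q]]
  have KL: "K \<subseteq> L"
    using fixed_field_subset[of "q ^ m" r] by (simp add: L_def K_def power_mult)
  have scalar: "to_ac c \<in> fixed_field (q ^ k)" for c :: 'a and k
  proof -
    have "to_ac c \<in> fixed_field q"
      by (simp add: fixed_field_def q_def power_card_field_eq_same flip: to_ac_power)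
    then show ?thesis using fixed_field_subset by blast
  qed
  have K0: "0 \<in> K" and K1: "1 \<in> K" and L0: "0 \<in> L"
    using q1 by (auto simp: L_def K_def zero fixed_field_1)
  have addK: "x + y \<in> K" and diffK: "x - y \<in> K" and multK: "x * y \<in> K" and divK: "x / y \<in> K"
    and powK: "x ^ k \<in> K" if "x \<in> K" "y \<in> K" for x y k
    using that by (auto simp: K_def add diff fixed_field_mult fixed_field_divide fixed_field_power)
  have addL: "x + y \<in> L" and multL: "x * y \<in> L" if "x \<in> L" "y \<in> L" for x y
    using that by (auto simp: L_def add fixed_field_mult)
  have scK: "to_ac c \<in> K" and scL: "to_ac c \<in> L" for c :: 'a
    by (auto simp: K_def L_def scalar)
  \<comment> \<open>The \<open>q\<close>-th power map fixes scalars and is additive, so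
    \<open>x ^ q - l * x\<close> is linear in \<open>x\<close> over the scalar field. This makes
    each \<open>T v l\<close> below a subspace.\<close>
  have frob_scalar: "to_ac c ^ q = to_ac c" for c :: 'a
    by (simp add: q_def power_card_field_eq_same flip: to_ac_power)
  have frob_add: "(x + y) ^ q = x ^ q + y ^ q" for x y :: "'a alg_closure"
    using freshmans_dream'[OF e(2,3)] .

  \<comment> \<open>The closure itself as a vector space, from which a subspace \<open>W\<close> of
    \<open>K\<close> is taken.\<close>
  define sk :: "'a \<Rightarrow> 'a alg_closure \<Rightarrow> 'a alg_closure" where "sk c x = to_ac c * x" for c x
  show vs: "vector_space sc"
    by unfold_locales (auto simp: sc_def algebra_simps)
  then interpret vector_space sc .
  have vsk: "vector_space sk"
    by unfold_locales (auto simp: sk_def algebra_simps)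
  then interpret k: vector_space sk .
  note card_dim = dim_eq_if_card[OF vs, folded q_def]
  have sc_simp: "sc c (x, y) = (to_ac c * x, to_ac c * y)" for c x y by (simp add: sc_def)
  show subY: "subspace (L \<times> K)"
    by (auto simp: subspace_def sc_simp zero_prod_def L0 K0 addL addK multL multK scK scL)
  show finY: "finite (L \<times> K)" using finL finK by simp
  show "dim (L \<times> K) = m * (r + 1)"
    using subY finY by (intro card_dim) (auto simp: card_cartesian_product cardL cardK power_add)

  have "k.subspace K"
    by (auto simp: k.subspace_def sk_def K0 addK multK scK)
  moreover from this have "k.dim K = m"
    using dim_eq_if_card[OF vsk _ finK] cardK by (simp add: q_def)
  \<comment> \<open>Dimension \<open>h - 1\<close> leaves room for one more: the fibres of
    \<open>x ^ q - l * x\<close> have up to \<open>q\<close> points.\<close>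
  ultimately obtain W where W: "k.subspace W" "W \<subseteq> K" "finite W" "card W = q ^ (h - 1)"
    using exists_subspace_of_dim[OF vsk, of K "h - 1"] h unfolding q_def
    by (metis diff_le_self le_trans)
  have addW: "x + y \<in> W" and scW: "to_ac c * x \<in> W"
    if "x \<in> W" "y \<in> W" for x y c
    using W(1) that by (auto simp: k.subspace_def sk_def)
  have W0: "0 \<in> W" using W(1) by (rule k.subspace_0)

  define T where "T v l = (\<lambda>x. (v * x, x ^ q - l * x)) ` K" for v l :: "'a alg_closure"
  define Tinf where "Tinf = {0 :: 'a alg_closure} \<times> K"
  \<comment> \<open>The choice is made from a set that depends only on the \<open>K\<close>-line
    through \<open>w\<close>, so all non-zero vectors of a line receive the same
    representative.\<close>
  define rep where "rep w = (SOME v. v \<in> (*) w ` (K - {0}))" for w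
  \<comment> \<open>Each line is listed once for every non-zero \<open>w\<close> on it; these
    repetitions collapse in the set because \<open>rep w\<close> is the same.\<close>
  define A where "A = insert Tinf {T (rep w) l | w l. w \<in> L - {0} \<and> l \<in> K}"
  define U where "U = L \<times> W"

  have rep: "rep w \<in> (*) w ` (K - {0})" for w
  proof -
    have "\<exists>v. v \<in> (*) w ` (K - {0})" using K1 by auto
    then show ?thesis unfolding rep_def by (rule someI_ex)
  qed
  \<comment> \<open>Multiplication by a non-zero \<open>x\<close> of \<open>K\<close> permutes
    \<open>K - {0}\<close>, so \<open>w\<close> and \<open>w * x\<close> choose from the same
    set.\<close>
  have rep_mult: "rep (w * x) = rep w" if "x \<in> K" "x \<noteq> 0" for w x
  proof -
    have "w * x * y \<in> (*) w ` (K - {0})" if "y \<in> K - {0}" for y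
      using that \<open>x \<in> K\<close> \<open>x \<noteq> 0\<close> multK by (intro image_eqI[of _ _ "x * y"]) (auto simp: mult.assoc)
    moreover have "w * y \<in> (*) (w * x) ` (K - {0})" if "y \<in> K - {0}" for y
      using that \<open>x \<in> K\<close> \<open>x \<noteq> 0\<close> divK by (intro image_eqI[of _ _ "y / x"]) auto
    ultimately have "(*) (w * x) ` (K - {0}) = (*) w ` (K - {0})"
      by blast
    then show ?thesis by (simp add: rep_def)
  qed
  have rep_rep: "rep (rep w) = rep w" for w
    using rep[of w] rep_mult by force
  have rep_L: "rep w \<in> L" "rep w \<noteq> 0" if "w \<in> L - {0}" for w
    using rep[of w] that multL KL by auto

  have T: "subspace (T v l)" "T v l \<subseteq> L \<times> K" "dim (T v l) = m"
    if "v \<in> L" "v \<noteq> 0" "l \<in> K" for v l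
  proof -
    show sub: "subspace (T v l)"
      unfolding subspace_def
    proof (intro conjI allI ballI)
      show "0 \<in> T v l"
        unfolding T_def zero_prod_def using q1 K0 by (intro image_eqI[of _ _ 0]) (auto simp: zero_power)
      fix a b c assume "a \<in> T v l"
      then obtain x where x: "x \<in> K" "a = (v * x, x ^ q - l * x)" by (auto simp: T_def)
      show "sc c a \<in> T v l"
        unfolding T_def using x multK[OF scK]
        by (intro image_eqI[of _ _ "to_ac c * x"])
          (auto simp: sc_simp power_mult_distrib frob_scalar algebra_simps)
      assume "b \<in> T v l"
      then obtain y where y: "y \<in> K" "b = (v * y, y ^ q - l * y)" by (auto simp: T_def)
      show "a + b \<in> T v l"
        unfolding T_def using x y addK
        by (intro image_eqI[of _ _ "x + y"]) (auto simp: frob_add algebra_simps)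
    qed
    show "T v l \<subseteq> L \<times> K"
      using that KL by (auto simp: T_def intro!: multL diffK powK multK)
    \<comment> \<open>The first coordinate alone recovers \<open>x\<close>, as \<open>v\<close> is
      non-zero.\<close>
    have "inj_on (\<lambda>x. (v * x, x ^ q - l * x)) K"
      using that by (auto simp: inj_on_def)
    then have "card (T v l) = q ^ m"
      by (simp add: T_def card_image cardK)
    then show "dim (T v l) = m"
      using sub finK by (intro card_dim) (auto simp: T_def)
  qed
  have Tinf: "subspace Tinf" "Tinf \<subseteq> L \<times> K" "dim Tinf = m"
  proof -
    show "subspace Tinf"
      by (auto simp: subspace_def Tinf_def sc_simp zero_prod_def K0 addK multK scK)
    then show "dim Tinf = m"
      using finK by (intro card_dim) (auto simp: Tinf_def card_cartesian_product cardK)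
  qed (auto simp: Tinf_def L0)
  have A_subspace: "subspace S" "S \<subseteq> L \<times> K" "dim S = m" if S: "S \<in> A" for S
  proof -
    consider "S = Tinf" | w l where "S = T (rep w) l" "w \<in> L - {0}" "l \<in> K"
      using S by (auto simp: A_def)
    then have "subspace S \<and> S \<subseteq> L \<times> K \<and> dim S = m"
      by cases (use Tinf T rep_L in simp_all)
    then show "subspace S" "S \<subseteq> L \<times> K" "dim S = m" by auto
  qed

  \<comment> \<open>Each non-zero vector lies in exactly one member\<close>
  have unique: "\<exists>!S. S \<in> A \<and> a \<in> S" if a: "a \<in> L \<times> K" "a \<noteq> 0" for a
  proof -
    obtain p z where pz: "a = (p, z)" "p \<in> L" "z \<in> K" using a by auto
    show ?thesis
    proof (cases "p = 0")
      case True
      then have "z \<noteq> 0" using a pz by (simp add: zero_prod_def)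
      show ?thesis
      proof (intro ex1I conjI)
        show "Tinf \<in> A" "a \<in> Tinf" using True pz by (auto simp: A_def Tinf_def)
        fix S assume S: "S \<in> A \<and> a \<in> S"
        \<comment> \<open>In any other member, first coordinate 0 forces \<open>x = 0\<close>, and
          then the second coordinate vanishes too, against \<open>z \<noteq> 0\<close>.\<close>
        show "S = Tinf"
        proof (rule ccontr)
          assume "S \<noteq> Tinf"
          then obtain w l where w: "w \<in> L - {0}" "S = T (rep w) l"
            using S by (auto simp: A_def)
          then obtain x where "p = rep w * x" "z = x ^ q - l * x"
            using S pz by (auto simp: T_def)
          then show False
            using True rep_L(2)[OF w(1)] \<open>z \<noteq> 0\<close> q1 by (simp add: zero_power)
        qed
      qed
    next
      case False
      obtain y where y: "y \<in> K" "y \<noteq> 0" "rep p = p * y" using rep[of p] by auto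
      \<comment> \<open>Since \<open>y\<close> carries \<open>p\<close> to its representative, its
        inverse is the parameter with \<open>p = rep p * x\<close>. The equation for the second
        coordinate is then linear in \<open>l\<close> and has one solution.\<close>
      define x where "x = 1 / y"
      have x: "x \<in> K" "x \<noteq> 0" "p = rep p * x"
        using y K1 divK by (auto simp: x_def)
      define l where "l = (x ^ q - z) / x"
      have "l \<in> K" using x pz by (auto simp: l_def intro!: divK diffK powK)
      have z: "z = x ^ q - l * x" using x by (simp add: l_def)
      show ?thesis
      proof (intro ex1I conjI)
        show "T (rep p) l \<in> A" using pz False \<open>l \<in> K\<close> by (auto simp: A_def)
        show "a \<in> T (rep p) l" using pz x z by (auto simp: T_def)
        fix S assume S: "S \<in> A \<and> a \<in> S"
        then have "S \<noteq> Tinf" using pz False by (auto simp: Tinf_def)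
        then obtain w k where w: "w \<in> L - {0}" "S = T (rep w) k"
          using S by (auto simp: A_def)
        then obtain x' where x': "x' \<in> K" "p = rep w * x'" "z = x' ^ q - k * x'"
          using S pz by (auto simp: T_def)
        then have "x' \<noteq> 0" using False by auto
        \<comment> \<open>The vector \<open>p\<close> is a non-zero \<open>K\<close>-multiple of
          \<open>rep w\<close>, so both have the same representative. Cancelling it gives
          \<open>x'\<close>, and the second coordinate then gives \<open>k\<close>.\<close>
        then have rw: "rep w = rep p"
          using x' rep_mult[of x' "rep w"] rep_rep by simp
        then have "x' = x"
          using x x'(2) False by (metis mult_cancel_left mult_zero_left)
        then have "k = l"
          using x'(3) x(2) by (simp add: l_def)
        then show "S = T (rep p) l" using w rw by simp
      qed
    qed
  qed

  have spread: "is_spread m (L \<times> K) A"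
    unfolding is_spread_def
  proof (intro conjI ballI impI)
    fix S S' assume S: "S \<in> A" "S' \<in> A" "S \<noteq> S'"
    \<comment> \<open>A common non-zero vector of two distinct members would contradict
      uniqueness.\<close>
    have "a = 0" if "a \<in> S" "a \<in> S'" for a
      using unique[of a] that S A_subspace(2) by blast
    moreover have "0 \<in> S" "0 \<in> S'" using S A_subspace(1) subspace_0 by auto
    ultimately show "S \<inter> S' = {0}" by auto
  qed (use A_subspace unique in auto)

  \<comment> \<open>The evasive subspace \<open>U\<close>\<close>
  have subU: "subspace U"
    by (auto simp: U_def subspace_def sc_simp zero_prod_def L0 W0 addL addW multL scW scL)
  have UY: "U \<subseteq> L \<times> K" using W(2) by (auto simp: U_def)
  \<comment> \<open>The count is \<open>q ^ (m * r) * q ^ (h - 1)\<close>; as \<open>h\<close> is at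
    least 1, the truncated subtraction is exact.\<close>
  have "dim U = m * r + h - 1"
    using subU UY finY h
    by (intro card_dim) (auto simp: U_def card_cartesian_product cardL W(4) simp flip: power_add
        intro: finite_subset)
  moreover have "dim (U \<inter> S) \<le> h" if S: "S \<in> A" for S
  proof -
    have "card (U \<inter> S) \<le> q ^ h"
    proof (cases "S = Tinf")
      case True
      then have "U \<inter> S = {0} \<times> W" using L0 W(2) by (auto simp: U_def Tinf_def)
      then show ?thesis
        using W(4) q1 h by (simp add: card_cartesian_product power_increasing)
    next
      case False
      then obtain w l where "S = T (rep w) l" using S by (auto simp: A_def)
      \<comment> \<open>Only the second coordinate restricts membership in \<open>U\<close>, since
        the first ranges over all of \<open>L\<close>. Solutions \<open>x\<close> are counted in the
        whole closure, where the bound \<open>q\<close> per value already holds.\<close>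
      then have "U \<inter> S \<subseteq> (\<lambda>x. (rep w * x, x ^ q - l * x)) ` (\<Union>u\<in>W. {x. x ^ q - l * x = u})"
        by (auto simp: U_def T_def)
      moreover have fin: "finite (\<Union>u\<in>W. {x. x ^ q - l * x = u})"
        using W(3) card_roots_linearized_le(1)[OF q1] by blast
      ultimately have "card (U \<inter> S) \<le> card (\<Union>u\<in>W. {x. x ^ q - l * x = u})"
        by (rule surj_card_le[rotated])
      also have "\<dots> \<le> (\<Sum>u\<in>W. card {x. x ^ q - l * x = u})"
        using W(3) by (rule card_UN_le)
      also have "\<dots> \<le> (\<Sum>u\<in>W. q)"
        by (intro sum_mono card_roots_linearized_le(2) q1)
      also have "\<dots> = q ^ h"
        using W(4) h by (simp add: power_Suc2[symmetric] del: power_Suc2)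
      finally show ?thesis .
    qed
    moreover have "finite (U \<inter> S)" using UY finY finite_subset by blast
    ultimately show ?thesis
      using dim_le_if_card_le[OF vs, folded q_def] subU A_subspace(1)[OF S] subspace_inter by blast
  qed
  ultimately show "\<exists>A U. is_spread m (L \<times> K) A \<and> is_evasive (L \<times> K) A h U \<and> dim U = m * r + h - 1"
    using spread subU UY unfolding is_evasive_def by blast
qed

section \<open>Transfer from the product of fields to an arbitrary space\<close>

theorem theorem3p5:
  fixes scale :: "'a::{field,finite} \<Rightarrow> 'b::ab_group_add \<Rightarrow> 'b"
    and X :: "'b set" and q m n h :: nat
  assumes "primepow q" and "card (UNIV :: 'a set) = q"
    and "m \<ge> 1" and "n \<ge> 2" and "1 \<le> h" and "h \<le> m"
    and "vector_space scale"
    and "module.subspace scale X"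
    and "vector_space.dim scale X = m * n"
  shows "\<exists>A. vector_space.is_spread scale m X A \<and>
           (\<exists>U. vector_space.is_evasive scale X A h U \<and>
                vector_space.dim scale U = m * (n - 1) + h - 1)"
proof -
  define sc :: "'a \<Rightarrow> 'a alg_closure \<times> 'a alg_closure \<Rightarrow> 'a alg_closure \<times> 'a alg_closure"
    where "sc = (\<lambda>c (x, y). (to_ac c * x, to_ac c * y))"
  define Y :: "('a alg_closure \<times> 'a alg_closure) set"
    where "Y = fixed_field (q ^ (m * (n - 1))) \<times> fixed_field (q ^ m)"
  note product = exists_spread_evasive_product[where 'a = 'a and m = m and r = "n - 1" and h = h,
      unfolded assms(2), folded sc_def Y_def]
  have "n - 1 \<ge> 1" using assms(4) by simp
  note product = product[OF assms(1,3) this assms(5,6)]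
  have Y: "vector_space sc" "module.subspace sc Y" "finite Y" "vector_space.dim sc Y = m * n"
    using product(1-4) assms by auto
  obtain A U where AU: "vector_space.is_spread sc m Y A" "vector_space.is_evasive sc Y A h U"
    "vector_space.dim sc U = m * (n - 1) + h - 1"
    using product(5) by blast
  \<comment> \<open>The dimension \<open>m * n\<close> is positive, hence not the default value of
    \<open>dim\<close>: \<open>X\<close> really is finite-dimensional and isomorphic to
    \<open>Y\<close>.\<close>
  obtain g where g: "Vector_Spaces.linear sc scale g" "inj_on g Y" "g ` Y = X"
    using exists_isomorphism[OF Y(1) assms(7) Y(2) assms(8)] Y(4) assms by auto
  show ?thesis
    using spread_evasive_image[OF g(1,2) Y(3,2) AU(1,2)] AU(3) g(3) by metis
qed

end
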